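(* Let $n$ be a non-negative integer and let $q,a,c$ be complex numbers with $q,a\neq 0$ such that no denominator on either side below vanishes. Then $${}_2\phi_1\left[\begin{matrix} a,\ q^{-n}\\ c\end{matrix};q,q\right]=\frac{(c/a;q)_n}{(c;q)_n}\,a^n .$$
   Context: For complex $a,q$ and a non-negative integer $n$, $(a;q)_n:=\prod_{k=0}^{n-1}(1-aq^k)$, with $(a;q)_0=1$, and $(a_1,\ldots,a_k;q)_n:=\prod_{i=1}^k (a_i;q)_n$. The unilateral basic hypergeometric series is $${}_{r+1}\phi_r\left[\begin{matrix} a_0,\ldots,a_r\\ b_1,\ldots,b_r\end{matrix};q,z\right]:=\sum_{j=0}^{\infty}\frac{(a_0,\ldots,a_r;q)_j}{(q,b_1,\ldots,b_r;q)_j}z^j .$$ When one numerator parameter is $q^{-n}$ the series terminates and is read as the finite sum over $0\le j\le n$ (so no convergence condition on $z$ is needed). *)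

theory Defs
  imports Complex_Main
begin

definition qpoch :: "complex \<Rightarrow> complex \<Rightarrow> nat \<Rightarrow> complex" where
  "qpoch a q n = (\<Prod>k<n. 1 - a * q ^ k)"

definition qpochs :: "complex list \<Rightarrow> complex \<Rightarrow> nat \<Rightarrow> complex" where
  "qpochs as q n = (\<Prod>a\<leftarrow>as. qpoch a q n)"

(* The series with numerator parameters as = [a_0, ..., a_r] and denominator
   parameters bs = [b_1, ..., b_r]; length as = length bs + 1 is understood. *)
definition basic_hypergeom ::
    "complex list \<Rightarrow> complex list \<Rightarrow> complex \<Rightarrow> complex \<Rightarrow> complex" where
  "basic_hypergeom as bs q z = (\<Sum>j. qpochs as q j / qpochs (q # bs) q j * z ^ j)"

(* With a numerator parameter q^(-n), all terms with j > n have numerator 0, so they are 0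
   (even where the denominator vanishes too, since 0 / 0 = 0 in HOL): the series is the
   finite sum over j <= n for every z. *)
lemma qpoch_powi_eq_0:
  assumes "q \<noteq> 0" and "n < j"
  shows "qpoch (q powi (- int n)) q j = 0"
proof -
  have "1 - q powi (- int n) * q ^ n = 0"
    using assms(1) by (simp add: power_int_minus)
  then show ?thesis
    using assms(2) unfolding qpoch_def by (intro prod_zero) auto
qed

lemma basic_hypergeom_terminating:
  assumes "q \<noteq> 0" and "q powi (- int n) \<in> set as"
  shows "basic_hypergeom as bs q z =
    (\<Sum>j\<le>n. qpochs as q j / qpochs (q # bs) q j * z ^ j)"
proof -
  have "qpochs as q j = 0" if "n < j" for j
    using assms(2) qpoch_powi_eq_0[OF assms(1) that]
    unfolding qpochs_def by (force simp: prod_list_zero_iff)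
  then show ?thesis
    unfolding basic_hypergeom_def by (intro suminf_finite) auto
qed

end

theory Submission
  imports Defs
begin

text \<open>
  This is the \<open>q\<close>-Chu--Vandermonde sum. Write \<open>S\<^sub>n(a, c)\<close> for the terminating series.
  Replacing the numerator parameter \<open>q\<^sup>-\<^sup>n\<close> by \<open>q\<^sup>-\<^sup>n\<^sup>-\<^sup>1\<close> adds to each term a fixed multiple
  of the preceding term of the series with parameters \<open>aq\<close> and \<open>cq\<close> (lemma \<open>vandermonde_term_contiguous\<close>):
  the two shifted factorials agree in all but one factor, and the difference of these two factors
  cancels the last factor \<open>1 - q\<^sup>j\<close> of the denominator. Summing over \<open>j\<close> gives
  \<open>S\<^sub>n\<^sub>+\<^sub>1(a, c) = S\<^sub>n(a, c) - q\<^sup>-\<^sup>n (1 - a)/(1 - c) S\<^sub>n(aq, cq)\<close>.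
  Since \<open>cq / aq = c / a\<close>, both series on the right have the numerator product \<open>(c/a; q)\<^sub>n\<close>
  by induction, and what remains is the identity
  \<open>(1 - c q\<^sup>n) - (1 - a) = a (1 - (c/a) q\<^sup>n)\<close>, which supplies the missing factor.
\<close>

lemma qpoch_0 [simp]: "qpoch a q 0 = 1"
  by (simp add: qpoch_def)

lemma qpoch_Suc: "qpoch a q (Suc n) = qpoch a q n * (1 - a * q ^ n)"
  by (simp add: qpoch_def)

lemma qpoch_Suc_shift: "qpoch a q (Suc n) = (1 - a) * qpoch (a * q) q n"
  unfolding qpoch_def by (subst prod.lessThan_Suc_shift) (simp add: mult.assoc)

text \<open>The parameter \<open>x\<close> stands for \<open>q\<^sup>-\<^sup>n\<close>. Leaving it free turns the step from \<open>n\<close> to \<open>n + 1\<close>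
  into the division of \<open>x\<close> by \<open>q\<close>.\<close>

definition vandermonde_term :: "complex \<Rightarrow> complex \<Rightarrow> complex \<Rightarrow> complex \<Rightarrow> nat \<Rightarrow> complex" where
  "vandermonde_term q a x c j =
     qpoch a q j * qpoch x q j / (qpoch q q j * qpoch c q j) * q ^ j"

lemma vandermonde_term_0 [simp]: "vandermonde_term q a x c 0 = 1"
  by (simp add: vandermonde_term_def)

text \<open>Both \<open>(x; q)\<^sub>j\<^sub>+\<^sub>1\<close> and \<open>(y; q)\<^sub>j\<^sub>+\<^sub>1\<close> contain \<open>(x; q)\<^sub>j\<close> when \<open>x = yq\<close>. The cofactors are
  \<open>1 - y q\<^sup>j\<^sup>+\<^sup>1\<close> and \<open>1 - y\<close>, whose difference is a multiple of \<open>1 - q\<^sup>j\<^sup>+\<^sup>1\<close>.\<close>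

lemma vandermonde_term_contiguous:
  assumes "q ^ Suc j \<noteq> 1"
  shows "vandermonde_term q a y c (Suc j) =
    vandermonde_term q a (y * q) c (Suc j)
      - y * q * (1 - a) / (1 - c) * vandermonde_term q (a * q) (y * q) (c * q) j"
proof -
  define A X C Q where "A = qpoch (a * q) q j" and "X = qpoch (y * q) q j"
    and "C = (1 - c) * qpoch (c * q) q j" and "Q = qpoch q q j"
  define p where "p = q ^ Suc j"
  have p: "1 - p \<noteq> 0"
    using assms by (simp add: p_def)
  have *: "vandermonde_term q a y c (Suc j) =
      (1 - a) * A * ((1 - y) * X) / (Q * (1 - p) * C) * p"
    unfolding vandermonde_term_def qpoch_Suc_shift[of a] qpoch_Suc_shift[of y]
      qpoch_Suc_shift[of c] qpoch_Suc[of q] A_def X_def C_def Q_def p_def by simp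
  have **: "vandermonde_term q a (y * q) c (Suc j) =
      (1 - a) * A * (X * (1 - y * p)) / (Q * (1 - p) * C) * p"
    unfolding vandermonde_term_def qpoch_Suc_shift[of a] qpoch_Suc[of "y * q"]
      qpoch_Suc_shift[of c] qpoch_Suc[of q] A_def X_def C_def Q_def p_def
    by (simp add: mult.assoc)
  have "vandermonde_term q a (y * q) c (Suc j) - vandermonde_term q a y c (Suc j) =
      (1 - a) * A * X * p * (y * (1 - p)) / (Q * (1 - p) * C)"
    unfolding * ** by (simp add: diff_divide_distrib[symmetric] algebra_simps)
  also have "\<dots> = (1 - a) * A * X * p * y / (Q * C)"
    using p by simp
  also have "\<dots> = y * q * (1 - a) / (1 - c) * vandermonde_term q (a * q) (y * q) (c * q) j"
    by (simp add: vandermonde_term_def A_def X_def C_def Q_def p_def mult_ac)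
  finally show ?thesis
    by (simp add: algebra_simps)
qed

text \<open>The induction runs over all \<open>a\<close> and \<open>c\<close> at once, because the contiguous relation leads to the
  series with parameters \<open>aq\<close> and \<open>cq\<close>.\<close>

lemma sum_vandermonde_term:
  assumes "q \<noteq> 0" and "a \<noteq> 0" and "qpoch q q n \<noteq> 0" and "qpoch c q n \<noteq> 0"
  shows "(\<Sum>j\<le>n. vandermonde_term q a (q powi (- int n)) c j) =
    qpoch (c / a) q n / qpoch c q n * a ^ n"
  using assms
proof (induction n arbitrary: a c)
  case 0
  then show ?case by simp
next
  case (Suc n)
  define x where "x = q powi (- int n)"
  define y where "y = q powi (- int (Suc n))"
  have yq: "y * q = x"
    using \<open>q \<noteq> 0\<close> by (simp add: x_def y_def power_int_minus del: of_nat_Suc)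
  have xq: "x * q ^ n = 1"
    using \<open>q \<noteq> 0\<close> by (simp add: x_def power_int_minus)
  have q_ne: "q ^ Suc j \<noteq> 1" if "j \<le> n" for j
  proof -
    have "\<forall>k\<in>{..<Suc n}. 1 - q * q ^ k \<noteq> 0"
      using Suc.prems(3) unfolding qpoch_def by (meson finite_lessThan prod_zero)
    then have "1 - q * q ^ j \<noteq> 0"
      using that by (meson le_imp_less_Suc lessThan_iff)
    then show ?thesis by simp
  qed
  have qn: "qpoch q q n \<noteq> 0" and cn: "qpoch c q n \<noteq> 0" and cq: "1 - c * q ^ n \<noteq> 0"
    using Suc.prems(3,4) by (auto simp: qpoch_Suc)
  have cqn: "qpoch (c * q) q n \<noteq> 0"
    using Suc.prems(4) by (auto simp: qpoch_Suc_shift)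
  have c_eq: "(1 - c) * qpoch (c * q) q n = qpoch c q n * (1 - c * q ^ n)"
    by (metis qpoch_Suc qpoch_Suc_shift)
  \<comment> \<open>The series for \<open>n\<close> may thus be summed over the same range as the one for \<open>n + 1\<close>.\<close>
  have vanish: "vandermonde_term q a x c (Suc n) = 0"
    using qpoch_powi_eq_0[OF \<open>q \<noteq> 0\<close>, of n "Suc n"] by (simp add: vandermonde_term_def x_def)
  have "(\<Sum>j\<le>Suc n. vandermonde_term q a y c j) =
      1 + (\<Sum>j\<le>n. vandermonde_term q a y c (Suc j))"
    by (subst sum.atMost_Suc_shift) simp
  also have "(\<Sum>j\<le>n. vandermonde_term q a y c (Suc j)) =
      (\<Sum>j\<le>n. vandermonde_term q a x c (Suc j)
         - x * (1 - a) / (1 - c) * vandermonde_term q (a * q) x (c * q) j)"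
    using vandermonde_term_contiguous[OF q_ne, of _ a y c]
    by (intro sum.cong) (simp_all only: yq atMost_iff)
  also have "1 + \<dots> = (\<Sum>j\<le>Suc n. vandermonde_term q a x c j)
      - x * (1 - a) / (1 - c) * (\<Sum>j\<le>n. vandermonde_term q (a * q) x (c * q) j)"
    by (simp add: sum.atMost_Suc_shift sum_subtractf sum_distrib_left del: sum.atMost_Suc)
  also have "(\<Sum>j\<le>Suc n. vandermonde_term q a x c j) =
      qpoch (c / a) q n / qpoch c q n * a ^ n"
    using Suc.IH[OF Suc.prems(1,2) qn cn] vanish by (simp add: x_def)
  also have "(\<Sum>j\<le>n. vandermonde_term q (a * q) x (c * q) j) =
      qpoch (c / a) q n / qpoch (c * q) q n * (a * q) ^ n"
    using Suc.IH[of "a * q" "c * q"] Suc.prems(1,2) qn cqn by (simp add: x_def)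
  also have "x * (1 - a) / (1 - c) * \<dots> =
      (x * q ^ n) * (1 - a) * qpoch (c / a) q n * a ^ n / ((1 - c) * qpoch (c * q) q n)"
    by (simp add: power_mult_distrib)
  also have "\<dots> = (1 - a) * qpoch (c / a) q n * a ^ n / (qpoch c q n * (1 - c * q ^ n))"
    by (simp only: xq c_eq mult_1_left)
  also have "qpoch (c / a) q n / qpoch c q n * a ^ n - \<dots> =
      qpoch (c / a) q n * a ^ n * ((1 - c * q ^ n) - (1 - a)) / (qpoch c q n * (1 - c * q ^ n))"
    using cn cq by (simp add: divide_simps) (simp add: algebra_simps)
  also have "(1 - c * q ^ n) - (1 - a) = a * (1 - c / a * q ^ n)"
    using \<open>a \<noteq> 0\<close> by (simp add: field_simps)
  finally show ?case
    by (simp add: qpoch_Suc y_def mult_ac)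
qed

theorem theorem1p2:
  fixes n :: nat and q a c :: complex
  assumes "q \<noteq> 0" and "a \<noteq> 0"
    and "\<And>j. j \<le> n \<Longrightarrow> qpochs [q, c] q j \<noteq> 0"
    and "qpoch c q n \<noteq> 0"
  shows "basic_hypergeom [a, q powi (- int n)] [c] q q
    = qpoch (c / a) q n / qpoch c q n * a ^ n"
proof -
  have "qpoch q q n \<noteq> 0"
    using assms(3)[of n] by (simp add: qpochs_def)
  moreover have "basic_hypergeom [a, q powi (- int n)] [c] q q =
      (\<Sum>j\<le>n. vandermonde_term q a (q powi (- int n)) c j)"
    by (subst basic_hypergeom_terminating[OF assms(1), of n])
      (simp_all add: qpochs_def vandermonde_term_def)
  ultimately show ?thesis
    using sum_vandermonde_term assms by simp
qed

end
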